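(* There is no finite non-commutative ring $R$ with commuting probability $$\Pr(R) = \frac{1}{2} + \frac{|Z(R)|}{|R|} - \frac{|Z(R)|^2}{2|R|^2}.$$
   Context: Rings are associative and not assumed to have a unity. $Z(R)$ is the center of $R$, and $\Pr(R) = \frac{|\{(r,t) \in R \times R : rt = tr\}|}{|R|^2}$ is the commuting probability of $R$. *)

theory Defs
  imports Complex_Main "HOL-Library.Cardinality"
begin

(* The type class ring is the class of associative rings without a unity requirement;
   a ring R is rendered as a type of this class, with UNIV as its underlying set. *)

definition ring_center :: "'a::ring set" where
  "ring_center = {z. \<forall>r. z * r = r * z}"

definition commuting_probability :: "'a::ring itself \<Rightarrow> real" where
  "commuting_probability _ =
     real (card {(r :: 'a, t :: 'a). r * t = t * r}) / (real CARD('a))\<^sup>2"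

end

theory Submission
  imports Defs
begin

text \<open>
  The centralizer of a non-central element is a proper additive subgroup, hence has at most
  \<open>|R| / 2\<close> elements. Summing the sizes of all centralizers gives
  \<open>Pr(R) \<le> 1/2 + |Z(R)| / (2 |R|)\<close>, and the proposed value exceeds this bound by
  \<open>|Z(R)| (|R| - |Z(R)|) / (2 |R|\<^sup>2) > 0\<close>.
\<close>

definition centralizer :: "'a::ring \<Rightarrow> 'a set" where
  "centralizer r = {t. r * t = t * r}"

lemma centralizer_central:
  "r \<in> ring_center \<Longrightarrow> centralizer r = UNIV"
  by (auto simp: ring_center_def centralizer_def)

text \<open>Translating the centralizer by some \<open>a\<close> outside it gives a disjoint set of
  the same size, and both fit into the ring.\<close>

lemma card_centralizer_noncentral:
  fixes r :: "'a::{ring,finite}"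
  assumes "r \<notin> ring_center"
  shows "2 * card (centralizer r) \<le> CARD('a)"
proof -
  let ?C = "centralizer r"
  from assms obtain a where a: "a \<notin> ?C"
    by (auto simp: ring_center_def centralizer_def)
  \<comment> \<open>If \<open>t\<close> and \<open>a + t\<close> both commuted with
    \<open>r\<close>, cancellation after distributing would make \<open>a\<close> commute with
    \<open>r\<close>.\<close>
  have "a + t \<notin> ?C" if "t \<in> ?C" for t
    using a that by (simp add: centralizer_def distrib_left distrib_right)
  then have "?C \<inter> (+) a ` ?C = {}"
    by blast
  then have "card (?C \<union> (+) a ` ?C) = card ?C + card ?C"
    by (simp add: card_Un_disjoint card_image)
  moreover have "card (?C \<union> (+) a ` ?C) \<le> CARD('a)"
    by (rule card_mono) auto
  ultimately show ?thesis by simp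
qed

text \<open>Pairs are counted by their first entry; the factor 2 keeps the halved bound within the
  naturals.\<close>

lemma card_commuting_pairs_le:
  "2 * card {(r :: 'a::{ring,finite}, t). r * t = t * r}
     \<le> CARD('a) * (CARD('a) + card (ring_center :: 'a set))"
proof -
  let ?Z = "ring_center :: 'a set"
  have "{(r :: 'a, t). r * t = t * r} = (SIGMA r:UNIV. centralizer r)"
    by (auto simp: centralizer_def)
  then have "2 * card {(r :: 'a, t). r * t = t * r} = (\<Sum>r::'a\<in>UNIV. 2 * card (centralizer r))"
    by (simp add: sum_distrib_left)
  \<comment> \<open>A central \<open>r\<close> contributes exactly \<open>2 * CARD('a)\<close>, any
    other at most \<open>CARD('a)\<close>.\<close>
  also have "\<dots> \<le> (\<Sum>r\<in>UNIV. CARD('a) + (if r \<in> ?Z then CARD('a) else 0))"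
    by (rule sum_mono) (simp add: centralizer_central card_centralizer_noncentral)
  also have "\<dots> = CARD('a) * (CARD('a) + card ?Z)"
    by (simp add: sum.distrib sum.If_cases algebra_simps)
  finally show ?thesis .
qed

lemma commuting_probability_le:
  "commuting_probability TYPE('a::{ring,finite})
     \<le> 1 / 2 + real (card (ring_center :: 'a set)) / (2 * real CARD('a))"
proof -
  have "2 * real (card {(r :: 'a, t). r * t = t * r})
      \<le> real CARD('a) * (real CARD('a) + real (card (ring_center :: 'a set)))"
    using of_nat_mono[OF card_commuting_pairs_le[where 'a = 'a], where 'a = real]
    by (simp only: of_nat_add of_nat_mult of_nat_numeral)
  then show ?thesis
    by (simp add: commuting_probability_def field_simps power2_eq_square)
qed

theorem proposition4p11:
  assumes noncommutative: "\<exists>x y :: 'a::{ring,finite}. x * y \<noteq> y * x"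
  shows "commuting_probability TYPE('a) \<noteq>
    1 / 2 + real (card (ring_center :: 'a set)) / real CARD('a)
      - (real (card (ring_center :: 'a set)))\<^sup>2 / (2 * (real CARD('a))\<^sup>2)"
proof -
  define n z where "n = real CARD('a)" and "z = real (card (ring_center :: 'a set))"
  \<comment> \<open>The gap computed below is strictly positive because \<open>0 < z < n\<close>:
    the zero element gives the first inequality, non-commutativity the second.\<close>
  have "(0 :: 'a) \<in> ring_center"
    by (simp add: ring_center_def)
  then have "z > 0"
    by (auto simp: z_def card_gt_0_iff)
  have "(ring_center :: 'a set) \<subset> UNIV"
    using noncommutative by (auto simp: ring_center_def)
  then have "z < n"
    by (simp add: n_def z_def psubset_card_mono)
  have "1 / 2 + z / n - z\<^sup>2 / (2 * n\<^sup>2) - (1 / 2 + z / (2 * n)) = z * (n - z) / (2 * n\<^sup>2)"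
    using \<open>z > 0\<close> \<open>z < n\<close> by (simp add: field_simps power2_eq_square)
  also have "\<dots> > 0"
    using \<open>z > 0\<close> \<open>z < n\<close> by simp
  finally show ?thesis
    using commuting_probability_le[where 'a = 'a] by (simp flip: n_def z_def)
qed

end
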